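(* Let $Y$ and $Z$ be spaces, and let $(X,\lambda)$, with continuous momentum maps $Y\xleftarrow{b}X\xrightarrow{f}Z$ and $\lambda=\{\lambda_z\}_{z\in Z}$ a family of measures along $f$, be a topological correspondence from $Y$ to $Z$. If $(X,\lambda)$ is a proper topological correspondence, then (i) for each $z\in Z$, the measure $\lambda_z$ is atomic; (ii) for each $z\in Z$, each atom in $\lambda_z$ is nonzero, and the function $\mathfrak D$ appearing in condition (iii) of the definition of a proper topological correspondence is positive. Thus the family of measures $\lambda$ has full support.
   Context: Spaces as groupoids. $Y$ and $Z$ are locally compact Hausdorff spaces regarded as groupoids in which every arrow is a unit, with Haar systems given by the point masses $\delta_y$, $\delta_z$. They act trivially on $X$ with momentum maps $r_X=b$ (left) and $s_X=f$ (right); thus $X/Z=X$. A topological correspondence from $Y$ to $Z$ then amounts to a locally compact space $X$, continuous maps $b,f$ and a continuous family of measures $\lambda$ along $f$ (proper in the sense defined below). Full support means $\mathrm{supp}(\lambda_z)=f^{-1}(z)$ for all $z\in Z$. Conventions. "Compact" means quasi-compact and Hausdorff; a space is locally compact if every point has a compact neighbourhood. A map of locally compact spaces is proper if inverse images of quasi-compact sets are quasi-compact. Measures are positive, Radon and $\sigma$-finite. For a locally compact space $P$, $C_c(P)$ is the linear span of the functions obtained by extending by zero continuous compactly supported functions on open Hausdorff subsets of $P$. In the definitions below $(G,\alpha)$, $(H,\beta)$ are locally compact groupoids (locally compact arrow space, Hausdorff unit space) with Haar systems (here $G=Y$, $H=Z$). For a left $G$-space $X$ with momentum map $r_X\colon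 X\to G^{(0)}$, put $G\times_{G^{(0)}}X=\{(\gamma,x): s_G(\gamma)=r_X(x)\}$, the arrow space of $G\ltimes X$. A $G$-$H$-bispace carries commuting continuous left $G$- and right $H$-actions. The $H$-action is proper if $(x,\eta)\mapsto(x\eta,x)$ into $X\times X$ is proper. Write $X\times_{s_X,H^{(0)},s_X}X=\{(x,y):s_X(x)=s_X(y)\}$ with the diagonal $H$-action. A continuous family of measures $\lambda=\{\lambda_u\}_{u\in H^{(0)}}$ along $s_X$ consists of measures $\lambda_u$ supported in $s_X^{-1}(u)$ with $u\mapsto\int g\,d\lambda_u$ continuous for $g\in C_c(X)$; it is proper if all $\lambda_u\neq0$, and $H$-invariant if $\int g(x\eta)\,d\lambda_{r_H(\eta)}(x)=\int g\,d\lambda_{s_H(\eta)}$ for all $\eta\in H$. Topological correspondence. A topological correspondence from $(G,\alpha)$ to $(H,\beta)$ is a pair $(X,\lambda)$ where $X$ is a locally compact $G$-$H$-bispace with proper $H$-action, $\lambda$ is an $H$-invariant proper continuous family of measures along $s_X$, and there is a continuous function $\Delta\colon G\ltimes X\to(0,\infty)$ with $$\int\!\!\int F(\gamma^{-1},x)\,d\alpha^{r_X(x)}(\gamma)\,d\lambda_u(x)=\int\!\!\int F(\gamma,\gamma^{-1}x)\,\Delta(\gamma,\gamma^{-1}x)\,d\alpha^{r_X(x)}(\gamma)\,d\lambda_u(x)$$ for all $u\in H^{(0)}$ and $F\in C_c(G\times_{G^{(0)}}X)$. Local homeomorphisms onto the image and extensions. A continuous map $\phi\colon P\to Q$ is open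 onto its image if $\phi(U)$ is open in $\phi(P)$ for all open $U\subseteq P$. $\phi^{\mathrm{Ho,Co}}$ is the collection of open $U\subseteq P$ with compact closure such that $\phi|_U$ and $\phi|_{\overline U}$ are homeomorphisms onto their images. An extension of an open $U\subseteq P$ via $\phi$ is an open $U'\subseteq Q$ with $U'\cap\phi(P)=\phi(U)$. $C_c(P,U)$ is the set of $g\in C_c(P)$ with $\mathrm{supp}(g)\subseteq U$. For $g\in C_c(P,U)$, an extension $g'\in C_c(Q,U')$ of $g$ via $\phi$ (with $U'$ an extension of $U$) is one with $g'\circ\phi|_U=g$ on $U$. For an open cover $\mathcal A$ of $P$, an extension of $\mathcal A$ via $\phi$ is a collection $\mathcal A'$ of open subsets of $Q$ such that each $U'\in\mathcal A'$ either is an extension of some $U\in\mathcal A$ or satisfies $U'\cap\phi(P)=\emptyset$, and each $U\in\mathcal A$ has at least one extension in $\mathcal A'$. Proper topological correspondence. Let $m_{s_X}\colon G\times_{G^{(0)}}X\to X\times_{s_X,H^{(0)},s_X}X$, $m_{s_X}(\gamma,x)=(\gamma x,x)$. The left action is locally strongly locally free if for every $\gamma\in G$ and every $y\in r_X^{-1}(s_G(\gamma))$ there are neighbourhoods $U$ of $\gamma$ and $V$ of $y$ such that for $\delta,\eta\in U$ and $x\in V$, $\eta x=\delta x$ implies $\eta=\delta$. A topological correspondence $(X,\lambda)$ with $X$ Hausdorff and $X/H$ paracompact is proper if there is an $H$-invariant nonnegative continuous function $\mathfrak D\colon X\times_{s_X,H^{(0)},s_X}X\to\mathbb R$ such that: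 (i) the left $G$-action is locally strongly locally free and $m_{s_X}$ is open onto its image; (ii) the map $[r_X]\colon X/H\to G^{(0)}$ induced by $r_X$ is proper; (iii) there are an open cover $\mathcal A$ of $G\times_{G^{(0)}}X$ consisting of sets in $m_{s_X}^{\mathrm{Ho,Co}}$ and an extension $\mathcal A'$ of $\mathcal A$ via $m_{s_X}$ such that for all $U\in\mathcal A$, every extension $U'\in\mathcal A'$ of $U$, every $g\in C_c(G\times_{G^{(0)}}X,U)$ and every extension $g'\in C_c(X\times_{s_X,H^{(0)},s_X}X,U')$ of $g$ via $m_{s_X}$, $$\int_X g'(x,y)\,\mathfrak D(x,y)\,d\lambda_{s_X(x)}(y)=\int_G g(\gamma,\gamma^{-1}x)\,d\alpha^{r_X(x)}(\gamma)\quad\text{for every }x\in X.$$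
   Formalization: Positivity of 𝔇 is proved on the diagonal only (𝔇(x,x) > 0 for all x in X, for every admissible 𝔇); on all of X ×_Z X it fails, e.g. X = Y = two points, Z = one point, b = id, counting measure, 𝔇 the indicator of the diagonal. *)

theory Defs
  imports "HOL-Probability.Probability"
begin

section \<open>Topology\<close>

(* Compact means quasi-compact and Hausdorff, so the compact neighbourhoods are required to be
   Hausdorff; the space itself need not be. *)
definition loc_compact :: "'a topology \<Rightarrow> bool" where
  "loc_compact P \<longleftrightarrow> (\<forall>x\<in>topspace P. \<exists>U K. openin P U \<and> x \<in> U \<and> U \<subseteq> K \<and>
      compactin P K \<and> Hausdorff_space (subtopology P K))"

(* Not the library's proper_map, which also asks for closedness. *)
definition proper_cmap :: "'a topology \<Rightarrow> 'b topology \<Rightarrow> ('a \<Rightarrow> 'b) \<Rightarrow> bool" where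
  "proper_cmap P Q \<phi> \<longleftrightarrow> continuous_map P Q \<phi> \<and>
     (\<forall>K. compactin Q K \<longrightarrow> compactin P {x \<in> topspace P. \<phi> x \<in> K})"

definition paracompact :: "'a topology \<Rightarrow> bool" where
  "paracompact P \<longleftrightarrow> Hausdorff_space P \<and>
     (\<forall>\<U>. (\<forall>U\<in>\<U>. openin P U) \<and> \<Union>\<U> = topspace P \<longrightarrow>
        (\<exists>\<V>. (\<forall>V\<in>\<V>. openin P V \<and> (\<exists>U\<in>\<U>. V \<subseteq> U)) \<and> \<Union>\<V> = topspace P \<and>
             locally_finite_in P \<V>))"

definition quot_topology :: "'a topology \<Rightarrow> ('a \<Rightarrow> 'b) \<Rightarrow> 'b topology" where
  "quot_topology P q =
     topology (\<lambda>U. U \<subseteq> q ` topspace P \<and> openin P {x \<in> topspace P. q x \<in> U})"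

lemma openin_quot_topology:
  "openin (quot_topology P q) U \<longleftrightarrow>
     U \<subseteq> q ` topspace P \<and> openin P {x \<in> topspace P. q x \<in> U}"
proof -
  have "istopology (\<lambda>U. U \<subseteq> q ` topspace P \<and> openin P {x \<in> topspace P. q x \<in> U})"
    unfolding istopology_def
  proof (intro conjI allI impI)
    fix S T assume "S \<subseteq> q ` topspace P \<and> openin P {x \<in> topspace P. q x \<in> S}"
      "T \<subseteq> q ` topspace P \<and> openin P {x \<in> topspace P. q x \<in> T}"
    then have "openin P ({x \<in> topspace P. q x \<in> S} \<inter> {x \<in> topspace P. q x \<in> T})"
      by (intro openin_Int) simp_all
    moreover have "{x \<in> topspace P. q x \<in> S} \<inter> {x \<in> topspace P. q x \<in> T}
        = {x \<in> topspace P. q x \<in> S \<inter> T}" by blast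
    ultimately show "openin P {x \<in> topspace P. q x \<in> S \<inter> T}" by simp
  next
    fix \<K> assume A: "\<forall>K\<in>\<K>. K \<subseteq> q ` topspace P \<and> openin P {x \<in> topspace P. q x \<in> K}"
    have "openin P (\<Union>K\<in>\<K>. {x \<in> topspace P. q x \<in> K})"
      using A by (intro openin_Union) auto
    moreover have "(\<Union>K\<in>\<K>. {x \<in> topspace P. q x \<in> K}) = {x \<in> topspace P. q x \<in> \<Union>\<K>}" by blast
    ultimately show "openin P {x \<in> topspace P. q x \<in> \<Union>\<K>}" by simp
  qed auto
  then show ?thesis by (simp add: quot_topology_def topology_inverse')
qed

lemma topspace_quot_topology: "topspace (quot_topology P q) = q ` topspace P"
proof
  show "topspace (quot_topology P q) \<subseteq> q ` topspace P"
    using openin_topspace[of "quot_topology P q"] unfolding openin_quot_topology by (rule conjunct1)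
  have "{x \<in> topspace P. q x \<in> q ` topspace P} = topspace P" by blast
  then have "openin (quot_topology P q) (q ` topspace P)"
    by (simp add: openin_quot_topology)
  then show "q ` topspace P \<subseteq> topspace (quot_topology P q)" by (rule openin_subset)
qed

lemma quotient_map_quot_topology: "quotient_map P (quot_topology P q) q"
  by (simp add: quotient_map_def topspace_quot_topology openin_quot_topology)

section \<open>Compactly supported functions and measures\<close>

(* The complex linear span of the generators. A generator h is a continuous compactly supported
   function on an open Hausdorff subset U, extended by zero; since U is Hausdorff, compact support
   in U means vanishing off some compact K contained in U. In particular all functions vanish
   off topspace P. *)
inductive_set Cc :: "'a topology \<Rightarrow> ('a \<Rightarrow> complex) set" for P :: "'a topology" where
  gen: "openin P U \<Longrightarrow> Hausdorff_space (subtopology P U) \<Longrightarrow>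
        continuous_map (subtopology P U) euclidean h \<Longrightarrow>
        compactin P K \<Longrightarrow> K \<subseteq> U \<Longrightarrow> (\<And>x. x \<notin> K \<Longrightarrow> h x = 0) \<Longrightarrow> h \<in> Cc P"
| add: "g \<in> Cc P \<Longrightarrow> h \<in> Cc P \<Longrightarrow> (\<lambda>x. g x + h x) \<in> Cc P"
| scale: "g \<in> Cc P \<Longrightarrow> (\<lambda>x. c * g x) \<in> Cc P"

definition fun_supp :: "'a topology \<Rightarrow> ('a \<Rightarrow> complex) \<Rightarrow> 'a set" where
  "fun_supp P g = P closure_of {x \<in> topspace P. g x \<noteq> 0}"

definition Cc_in :: "'a topology \<Rightarrow> 'a set \<Rightarrow> ('a \<Rightarrow> complex) set" where
  "Cc_in P U = {g \<in> Cc P. fun_supp P g \<subseteq> U}"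

definition borel_on :: "'a topology \<Rightarrow> 'a measure" where
  "borel_on P = sigma (topspace P) {U. openin P U}"

(* A locally Hausdorff P is tested on its open Hausdorff subsets; for Hausdorff P the case
   U = topspace P gives the usual notion (finite on compact sets, tight). *)
definition radon :: "'a topology \<Rightarrow> 'a measure \<Rightarrow> bool" where
  "radon P M \<longleftrightarrow> space M = topspace P \<and> sets M = sets (borel_on P) \<and> sigma_finite_measure M \<and>
     (\<forall>U. openin P U \<and> Hausdorff_space (subtopology P U) \<longrightarrow>
        (\<forall>K. compactin P K \<and> K \<subseteq> U \<longrightarrow> emeasure M K < \<infinity>) \<and>
        (\<forall>A\<in>sets M. A \<subseteq> U \<longrightarrow>
            emeasure M A = (SUP K \<in> {K. compactin P K \<and> K \<subseteq> A}. emeasure M K)))"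

definition meas_supp :: "'a topology \<Rightarrow> 'a measure \<Rightarrow> 'a set" where
  "meas_supp P M = {x \<in> topspace P. \<forall>U. openin P U \<and> x \<in> U \<longrightarrow> emeasure M U \<noteq> 0}"

(* M is the sum of its point masses M{x} at x, the atoms of M being points. *)
definition atomic_measure :: "'a measure \<Rightarrow> bool" where
  "atomic_measure M \<longleftrightarrow>
     (\<forall>A\<in>sets M. emeasure M A = (\<integral>\<^sup>+ x. emeasure M {x} \<partial>count_space A))"

definition fiber :: "'a topology \<Rightarrow> ('a \<Rightarrow> 'b) \<Rightarrow> 'b \<Rightarrow> 'a set" where
  "fiber P p u = {x \<in> topspace P. p x = u}"

definition continuous_family ::
    "'a topology \<Rightarrow> 'b topology \<Rightarrow> ('a \<Rightarrow> 'b) \<Rightarrow> ('b \<Rightarrow> 'a measure) \<Rightarrow> bool" where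
  "continuous_family P B p m \<longleftrightarrow>
     (\<forall>u\<in>topspace B. radon P (m u) \<and> emeasure (m u) (topspace P - fiber P p u) = 0) \<and>
     (\<forall>g\<in>Cc P. continuous_map B euclidean (\<lambda>u. LINT x|m u. g x))"

definition proper_family :: "'a topology \<Rightarrow> 'b topology \<Rightarrow> ('b \<Rightarrow> 'a measure) \<Rightarrow> bool" where
  "proper_family P B m \<longleftrightarrow> (\<forall>u\<in>topspace B. emeasure (m u) (topspace P) \<noteq> 0)"

section \<open>Locally compact groupoids with Haar systems\<close>

(* Units are identified with the identity arrows; "mult g h" is meaningful for "src g = rng h". *)
record 'g tgroupoid =
  arrows :: "'g topology"
  src :: "'g \<Rightarrow> 'g"
  rng :: "'g \<Rightarrow> 'g"
  mult :: "'g \<Rightarrow> 'g \<Rightarrow> 'g"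
  ginv :: "'g \<Rightarrow> 'g"

definition unit_space :: "'g tgroupoid \<Rightarrow> 'g topology" where
  "unit_space G = subtopology (arrows G) (src G ` topspace (arrows G))"

definition composable :: "'g tgroupoid \<Rightarrow> ('g \<times> 'g) topology" where
  "composable G = subtopology (prod_topology (arrows G) (arrows G)) {(g, h). src G g = rng G h}"

definition groupoid :: "'g tgroupoid \<Rightarrow> bool" where
  "groupoid G \<longleftrightarrow>
     (\<forall>g\<in>topspace (arrows G).
        src G g \<in> topspace (arrows G) \<and> rng G g \<in> topspace (arrows G) \<and>
        ginv G g \<in> topspace (arrows G) \<and>
        src G (src G g) = src G g \<and> rng G (src G g) = src G g \<and>
        src G (rng G g) = rng G g \<and> rng G (rng G g) = rng G g \<and>
        src G (ginv G g) = rng G g \<and> rng G (ginv G g) = src G g \<and>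
        mult G (rng G g) g = g \<and> mult G g (src G g) = g \<and>
        mult G g (ginv G g) = rng G g \<and> mult G (ginv G g) g = src G g) \<and>
     (\<forall>g\<in>topspace (arrows G). \<forall>h\<in>topspace (arrows G). src G g = rng G h \<longrightarrow>
        mult G g h \<in> topspace (arrows G) \<and>
        src G (mult G g h) = src G h \<and> rng G (mult G g h) = rng G g) \<and>
     (\<forall>g\<in>topspace (arrows G). \<forall>h\<in>topspace (arrows G). \<forall>k\<in>topspace (arrows G).
        src G g = rng G h \<and> src G h = rng G k \<longrightarrow>
        mult G (mult G g h) k = mult G g (mult G h k))"

definition lc_groupoid :: "'g tgroupoid \<Rightarrow> bool" where
  "lc_groupoid G \<longleftrightarrow> groupoid G \<and>
     continuous_map (arrows G) (arrows G) (src G) \<and>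
     continuous_map (arrows G) (arrows G) (rng G) \<and>
     continuous_map (arrows G) (arrows G) (ginv G) \<and>
     continuous_map (composable G) (arrows G) (\<lambda>(g, h). mult G g h) \<and>
     loc_compact (arrows G) \<and> Hausdorff_space (unit_space G)"

(* Invariance is integrated over the fiber of src g, where the translate of f by g is defined. *)
definition haar_system :: "'g tgroupoid \<Rightarrow> ('g \<Rightarrow> 'g measure) \<Rightarrow> bool" where
  "haar_system G \<alpha> \<longleftrightarrow>
     continuous_family (arrows G) (unit_space G) (rng G) \<alpha> \<and>
     (\<forall>u\<in>topspace (unit_space G). meas_supp (arrows G) (\<alpha> u) = fiber (arrows G) (rng G) u) \<and>
     (\<forall>g\<in>topspace (arrows G). \<forall>f\<in>Cc (arrows G).
        (LINT h:fiber (arrows G) (rng G) (src G g)|\<alpha> (src G g). f (mult G g h))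
        = (LINT h|\<alpha> (rng G g). f h))"

section \<open>Bispaces and topological correspondences\<close>

record ('g, 'h, 'x) bispace =
  carr :: "'x topology"
  lmom :: "'x \<Rightarrow> 'g"
  rmom :: "'x \<Rightarrow> 'h"
  lact :: "'g \<Rightarrow> 'x \<Rightarrow> 'x"
  ract :: "'x \<Rightarrow> 'h \<Rightarrow> 'x"

(* The arrow space of the transformation groupoid of G and X. *)
definition lprod :: "'g tgroupoid \<Rightarrow> ('g, 'h, 'x) bispace \<Rightarrow> ('g \<times> 'x) topology" where
  "lprod G X = subtopology (prod_topology (arrows G) (carr X)) {(g, x). src G g = lmom X x}"

definition rprod :: "'h tgroupoid \<Rightarrow> ('g, 'h, 'x) bispace \<Rightarrow> ('x \<times> 'h) topology" where
  "rprod H X = subtopology (prod_topology (carr X) (arrows H)) {(x, h). rmom X x = rng H h}"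

definition fibprod :: "('g, 'h, 'x) bispace \<Rightarrow> ('x \<times> 'x) topology" where
  "fibprod X = subtopology (prod_topology (carr X) (carr X)) {(x, y). rmom X x = rmom X y}"

definition left_space :: "'g tgroupoid \<Rightarrow> ('g, 'h, 'x) bispace \<Rightarrow> bool" where
  "left_space G X \<longleftrightarrow>
     continuous_map (carr X) (unit_space G) (lmom X) \<and>
     continuous_map (lprod G X) (carr X) (\<lambda>(g, x). lact X g x) \<and>
     (\<forall>x\<in>topspace (carr X). lact X (lmom X x) x = x) \<and>
     (\<forall>(g, x)\<in>topspace (lprod G X). lmom X (lact X g x) = rng G g \<and>
        (\<forall>k\<in>topspace (arrows G). src G k = rng G g \<longrightarrow>
            lact X (mult G k g) x = lact X k (lact X g x)))"

definition right_space :: "'h tgroupoid \<Rightarrow> ('g, 'h, 'x) bispace \<Rightarrow> bool" where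
  "right_space H X \<longleftrightarrow>
     continuous_map (carr X) (unit_space H) (rmom X) \<and>
     continuous_map (rprod H X) (carr X) (\<lambda>(x, h). ract X x h) \<and>
     (\<forall>x\<in>topspace (carr X). ract X x (rmom X x) = x) \<and>
     (\<forall>(x, h)\<in>topspace (rprod H X). rmom X (ract X x h) = src H h \<and>
        (\<forall>k\<in>topspace (arrows H). src H h = rng H k \<longrightarrow>
            ract X x (mult H h k) = ract X (ract X x h) k))"

definition is_bispace :: "'g tgroupoid \<Rightarrow> 'h tgroupoid \<Rightarrow> ('g, 'h, 'x) bispace \<Rightarrow> bool" where
  "is_bispace G H X \<longleftrightarrow> left_space G X \<and> right_space H X \<and>
     (\<forall>(g, x)\<in>topspace (lprod G X). rmom X (lact X g x) = rmom X x) \<and>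
     (\<forall>(x, h)\<in>topspace (rprod H X). lmom X (ract X x h) = lmom X x) \<and>
     (\<forall>g\<in>topspace (arrows G). \<forall>x\<in>topspace (carr X). \<forall>h\<in>topspace (arrows H).
        src G g = lmom X x \<and> rmom X x = rng H h \<longrightarrow>
        ract X (lact X g x) h = lact X g (ract X x h))"

definition proper_ract :: "'h tgroupoid \<Rightarrow> ('g, 'h, 'x) bispace \<Rightarrow> bool" where
  "proper_ract H X \<longleftrightarrow>
     proper_cmap (rprod H X) (prod_topology (carr X) (carr X)) (\<lambda>(x, h). (ract X x h, x))"

definition invariant_family ::
    "'h tgroupoid \<Rightarrow> ('g, 'h, 'x) bispace \<Rightarrow> ('h \<Rightarrow> 'x measure) \<Rightarrow> bool" where
  "invariant_family H X lam \<longleftrightarrow>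
     (\<forall>h\<in>topspace (arrows H). \<forall>g\<in>Cc (carr X).
        (LINT x:fiber (carr X) (rmom X) (rng H h)|lam (rng H h). g (ract X x h))
        = (LINT x|lam (src H h). g x))"

(* Integrals against the Haar measure at u are taken over the range fiber of u, where
   the integrands are defined. *)
definition topological_correspondence ::
    "'g tgroupoid \<Rightarrow> ('g \<Rightarrow> 'g measure) \<Rightarrow> 'h tgroupoid \<Rightarrow> ('h \<Rightarrow> 'h measure) \<Rightarrow>
     ('g, 'h, 'x) bispace \<Rightarrow> ('h \<Rightarrow> 'x measure) \<Rightarrow> bool" where
  "topological_correspondence G \<alpha> H \<beta> X lam \<longleftrightarrow>
     lc_groupoid G \<and> haar_system G \<alpha> \<and> lc_groupoid H \<and> haar_system H \<beta> \<and>
     loc_compact (carr X) \<and> is_bispace G H X \<and> proper_ract H X \<and>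
     continuous_family (carr X) (unit_space H) (rmom X) lam \<and>
     proper_family (carr X) (unit_space H) lam \<and>
     invariant_family H X lam \<and>
     (\<exists>\<Delta> :: 'g \<times> 'x \<Rightarrow> real.
        continuous_map (lprod G X) euclideanreal \<Delta> \<and>
        (\<forall>p\<in>topspace (lprod G X). 0 < \<Delta> p) \<and>
        (\<forall>u\<in>topspace (unit_space H). \<forall>F\<in>Cc (lprod G X).
          (LINT x|lam u. (LINT g:fiber (arrows G) (rng G) (lmom X x)|\<alpha> (lmom X x).
              F (ginv G g, x)))
          = (LINT x|lam u. (LINT g:fiber (arrows G) (rng G) (lmom X x)|\<alpha> (lmom X x).
              F (g, lact X (ginv G g) x) * of_real (\<Delta> (g, lact X (ginv G g) x))))))"

section \<open>Local homeomorphisms onto the image and extensions\<close>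

definition open_onto_image :: "'a topology \<Rightarrow> 'b topology \<Rightarrow> ('a \<Rightarrow> 'b) \<Rightarrow> bool" where
  "open_onto_image P Q \<phi> \<longleftrightarrow> continuous_map P Q \<phi> \<and>
     open_map P (subtopology Q (\<phi> ` topspace P)) \<phi>"

definition HoCo :: "'a topology \<Rightarrow> 'b topology \<Rightarrow> ('a \<Rightarrow> 'b) \<Rightarrow> 'a set set" where
  "HoCo P Q \<phi> = {U. openin P U \<and> compactin P (P closure_of U) \<and>
     Hausdorff_space (subtopology P (P closure_of U)) \<and>
     embedding_map (subtopology P U) Q \<phi> \<and>
     embedding_map (subtopology P (P closure_of U)) Q \<phi>}"

definition set_ext ::
    "'a topology \<Rightarrow> 'b topology \<Rightarrow> ('a \<Rightarrow> 'b) \<Rightarrow> 'a set \<Rightarrow> 'b set \<Rightarrow> bool" where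
  "set_ext P Q \<phi> U U' \<longleftrightarrow> openin P U \<and> openin Q U' \<and> U' \<inter> \<phi> ` topspace P = \<phi> ` U"

definition cover_ext ::
    "'a topology \<Rightarrow> 'b topology \<Rightarrow> ('a \<Rightarrow> 'b) \<Rightarrow> 'a set set \<Rightarrow> 'b set set \<Rightarrow> bool" where
  "cover_ext P Q \<phi> \<A> \<A>' \<longleftrightarrow>
     (\<forall>U'\<in>\<A>'. openin Q U' \<and> ((\<exists>U\<in>\<A>. set_ext P Q \<phi> U U') \<or> U' \<inter> \<phi> ` topspace P = {})) \<and>
     (\<forall>U\<in>\<A>. \<exists>U'\<in>\<A>'. set_ext P Q \<phi> U U')"

section \<open>Proper topological correspondences\<close>

definition mmap :: "('g, 'h, 'x) bispace \<Rightarrow> 'g \<times> 'x \<Rightarrow> 'x \<times> 'x" where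
  "mmap X = (\<lambda>(g, x). (lact X g x, x))"

definition loc_strongly_loc_free :: "'g tgroupoid \<Rightarrow> ('g, 'h, 'x) bispace \<Rightarrow> bool" where
  "loc_strongly_loc_free G X \<longleftrightarrow>
     (\<forall>g\<in>topspace (arrows G). \<forall>y\<in>fiber (carr X) (lmom X) (src G g).
        \<exists>U V. openin (arrows G) U \<and> g \<in> U \<and> openin (carr X) V \<and> y \<in> V \<and>
          (\<forall>d\<in>U. \<forall>e\<in>U. \<forall>x\<in>V. src G d = lmom X x \<and> src G e = lmom X x \<and>
              lact X e x = lact X d x \<longrightarrow> e = d))"

definition orbit :: "'h tgroupoid \<Rightarrow> ('g, 'h, 'x) bispace \<Rightarrow> 'x \<Rightarrow> 'x set" where
  "orbit H X x = {ract X x h | h. h \<in> topspace (arrows H) \<and> rng H h = rmom X x}"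

definition orbit_space :: "'h tgroupoid \<Rightarrow> ('g, 'h, 'x) bispace \<Rightarrow> 'x set topology" where
  "orbit_space H X = quot_topology (carr X) (orbit H X)"

(* The momentum map lmom X is constant on H-orbits. *)
definition lmom_ind :: "('g, 'h, 'x) bispace \<Rightarrow> 'x set \<Rightarrow> 'g" where
  "lmom_ind X w = the_elem (lmom X ` w)"

(* Only D at points of the members of \<A>' that extend members of \<A> is constrained by the
   integral formula. For spaces seen as groupoids mmap is the diagonal embedding of X, and taking
   g = 0 shows that D vanishes off the diagonal at such points, as far as lam charges them. *)
definition adjoining_function ::
    "'g tgroupoid \<Rightarrow> ('g \<Rightarrow> 'g measure) \<Rightarrow> 'h tgroupoid \<Rightarrow>
     ('g, 'h, 'x) bispace \<Rightarrow> ('h \<Rightarrow> 'x measure) \<Rightarrow> ('x \<times> 'x \<Rightarrow> real) \<Rightarrow> bool" where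
  "adjoining_function G \<alpha> H X lam D \<longleftrightarrow>
     continuous_map (fibprod X) euclideanreal D \<and>
     (\<forall>p\<in>topspace (fibprod X). 0 \<le> D p) \<and>
     (\<forall>(x, y)\<in>topspace (fibprod X). \<forall>h\<in>topspace (arrows H). rmom X x = rng H h \<longrightarrow>
        D (ract X x h, ract X y h) = D (x, y)) \<and>
     (\<exists>\<A> \<A>'. \<A> \<subseteq> HoCo (lprod G X) (fibprod X) (mmap X) \<and> \<Union>\<A> = topspace (lprod G X) \<and>
        cover_ext (lprod G X) (fibprod X) (mmap X) \<A> \<A>' \<and>
        (\<forall>U\<in>\<A>. \<forall>U'\<in>\<A>'. set_ext (lprod G X) (fibprod X) (mmap X) U U' \<longrightarrow>
          (\<forall>g\<in>Cc_in (lprod G X) U. \<forall>g'\<in>Cc_in (fibprod X) U'.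
             (\<forall>p\<in>U. g' (mmap X p) = g p) \<longrightarrow>
             (\<forall>x\<in>topspace (carr X).
                (LINT y|lam (rmom X x). g' (x, y) * of_real (D (x, y)))
                = (LINT k:fiber (arrows G) (rng G) (lmom X x)|\<alpha> (lmom X x).
                     g (k, lact X (ginv G k) x))))))"

(* To be read together with topological_correspondence. *)
definition proper_correspondence ::
    "'g tgroupoid \<Rightarrow> ('g \<Rightarrow> 'g measure) \<Rightarrow> 'h tgroupoid \<Rightarrow>
     ('g, 'h, 'x) bispace \<Rightarrow> ('h \<Rightarrow> 'x measure) \<Rightarrow> bool" where
  "proper_correspondence G \<alpha> H X lam \<longleftrightarrow>
     Hausdorff_space (carr X) \<and> paracompact (orbit_space H X) \<and>
     loc_strongly_loc_free G X \<and>
     open_onto_image (lprod G X) (fibprod X) (mmap X) \<and>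
     proper_cmap (orbit_space H X) (unit_space G) (lmom_ind X) \<and>
     (\<exists>D. adjoining_function G \<alpha> H X lam D)"

section \<open>Spaces as groupoids\<close>

definition space_groupoid :: "'y topology \<Rightarrow> 'y tgroupoid" where
  "space_groupoid Y =
     \<lparr>arrows = Y, src = (\<lambda>y. y), rng = (\<lambda>y. y), mult = (\<lambda>y y'. y), ginv = (\<lambda>y. y)\<rparr>"

definition point_masses :: "'y topology \<Rightarrow> 'y \<Rightarrow> 'y measure" where
  "point_masses Y y = return (borel_on Y) y"

definition space_bispace ::
    "'x topology \<Rightarrow> ('x \<Rightarrow> 'y) \<Rightarrow> ('x \<Rightarrow> 'z) \<Rightarrow> ('y, 'z, 'x) bispace" where
  "space_bispace X b f =
     \<lparr>carr = X, lmom = b, rmom = f, lact = (\<lambda>y x. x), ract = (\<lambda>x z. x)\<rparr>"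

lemma space_borel_on [simp]: "space (borel_on P) = topspace P"
  unfolding borel_on_def by (rule space_measure_of) (auto dest: openin_subset)

lemma sets_borel_on: "sets (borel_on P) = sigma_sets (topspace P) {U. openin P U}"
  unfolding borel_on_def by (rule sets_measure_of) (auto dest: openin_subset)

lemma openin_borel_on: "openin P U \<Longrightarrow> U \<in> sets (borel_on P)"
  by (simp add: sets_borel_on)

lemma closedin_borel_on:
  assumes "closedin P C" shows "C \<in> sets (borel_on P)"
proof -
  have "topspace P - (topspace P - C) \<in> sets (borel_on P)"
    using assms openin_borel_on[of P "topspace P - C"]
    by (metis closedin_def sets.compl_sets space_borel_on)
  then show ?thesis using closedin_subset[OF assms] by (simp add: double_diff)
qed

lemma fiber_id: "fiber Y (\<lambda>y. y) y = (if y \<in> topspace Y then {y} else {})"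
  by (auto simp: fiber_def)

lemma Cc_continuous:
  assumes "Hausdorff_space Y" "g \<in> Cc Y"
  shows "continuous_map Y euclidean g"
  using assms(2)
proof induction
  case (gen U h K)
  have *: "openin Y {x \<in> topspace Y. h x \<in> W}" if "open W" for W
  proof -
    have "openin (subtopology Y U) {x \<in> topspace (subtopology Y U). h x \<in> W}"
      using gen(3) that by (auto simp: continuous_map_def)
    then have 1: "openin Y {x \<in> topspace (subtopology Y U). h x \<in> W}"
      using gen(1) openin_trans_full by blast
    have 2: "openin Y (topspace Y - K)"
      using compactin_imp_closedin[OF assms(1) gen(4)] by blast
    have "{x \<in> topspace Y. h x \<in> W} = {x \<in> topspace (subtopology Y U). h x \<in> W} \<union>
        (if 0 \<in> W then topspace Y - K else {})"
    proof (intro set_eqI)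
      fix x
      show "x \<in> {x \<in> topspace Y. h x \<in> W} \<longleftrightarrow>
          x \<in> {x \<in> topspace (subtopology Y U). h x \<in> W} \<union> (if 0 \<in> W then topspace Y - K else {})"
        using gen(5) gen(6)[of x] by (cases "x \<in> K"; cases "0 \<in> W") auto
    qed
    then show ?thesis using 1 2 by (simp add: openin_Un)
  qed
  show ?case by (simp add: continuous_map_def *)
next
  case (add g h)
  then show ?case by (intro continuous_map_add)
next
  case (scale g c)
  have "continuous_map euclidean euclidean (\<lambda>z::complex. c * z)"
    by (simp add: continuous_intros)
  from continuous_map_compose[OF scale.IH this] show ?case by (simp add: o_def)
qed

lemma continuous_borel_on:
  assumes "continuous_map Y euclidean (g :: 'a \<Rightarrow> complex)"
  shows "g \<in> borel_measurable (borel_on Y)"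
proof (rule borel_measurableI)
  fix S :: "complex set" assume "open S"
  then have "openin Y {x \<in> topspace Y. g x \<in> S}"
    using assms by (auto simp: continuous_map_def)
  moreover have "g -` S \<inter> space (borel_on Y) = {x \<in> topspace Y. g x \<in> S}" by auto
  ultimately show "g -` S \<inter> space (borel_on Y) \<in> sets (borel_on Y)"
    using openin_borel_on by metis
qed

lemma unit_space_space_groupoid [simp]: "unit_space (space_groupoid Y) = Y"
  by (simp add: unit_space_def space_groupoid_def subtopology_topspace)

lemma lc_groupoid_space_groupoid:
  assumes "locally_compact_space Y" "Hausdorff_space Y"
  shows "lc_groupoid (space_groupoid Y)"
proof -
  have "loc_compact Y"
    using assms unfolding loc_compact_def locally_compact_space_def
    by (meson Hausdorff_space_subtopology)
  moreover have "continuous_map (composable (space_groupoid Y)) Y (\<lambda>(g, h). g)"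
    by (simp add: composable_def continuous_map_from_subtopology continuous_map_fst
        case_prod_unfold space_groupoid_def)
  moreover have "groupoid (space_groupoid Y)"
    by (simp add: groupoid_def space_groupoid_def)
  moreover have "Hausdorff_space (unit_space (space_groupoid Y))" using assms by simp
  ultimately show ?thesis
    unfolding lc_groupoid_def by (simp add: space_groupoid_def)
qed

lemma radon_point_masses:
  assumes "Hausdorff_space Y" "y \<in> topspace Y"
  shows "radon Y (point_masses Y y)"
proof -
  let ?M = "point_masses Y y"
  interpret prob_space ?M
    unfolding point_masses_def by (rule prob_space_return) (simp add: assms)
  have y: "{y} \<in> sets (borel_on Y)"
    by (rule closedin_borel_on)
      (use assms in \<open>auto intro: closedin_Hausdorff_singleton\<close>)
  have "emeasure ?M A = (SUP K \<in> {K. compactin Y K \<and> K \<subseteq> A}. emeasure ?M K)"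
    if A: "A \<in> sets ?M" for A
  proof (rule antisym)
    have A': "A \<in> sets (borel_on Y)" using A by (simp add: point_masses_def)
    show "emeasure ?M A \<le> (SUP K \<in> {K. compactin Y K \<and> K \<subseteq> A}. emeasure ?M K)"
    proof (cases "y \<in> A")
      case True
      have "emeasure ?M A = emeasure ?M {y}"
        using y A' True by (simp add: point_masses_def)
      also have "\<dots> \<le> (SUP K \<in> {K. compactin Y K \<and> K \<subseteq> A}. emeasure ?M K)"
        using True assms by (intro SUP_upper) auto
      finally show ?thesis .
    qed (use A' in \<open>simp add: point_masses_def\<close>)
    show "(SUP K \<in> {K. compactin Y K \<and> K \<subseteq> A}. emeasure ?M K) \<le> emeasure ?M A"
      using A by (intro SUP_least emeasure_mono) auto
  qed
  moreover have "emeasure ?M K < \<infinity>" for K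
    by (simp add: less_top[symmetric])
  moreover have "sigma_finite_measure ?M" by unfold_locales
  moreover have "space ?M = topspace Y" "sets ?M = sets (borel_on Y)"
    by (simp_all add: point_masses_def)
  ultimately show ?thesis unfolding radon_def by blast
qed

lemma haar_system_space_groupoid:
  assumes "Hausdorff_space Y"
  shows "haar_system (space_groupoid Y) (point_masses Y)"
proof -
  have sgl: "{y} \<in> sets (borel_on Y)" if "y \<in> topspace Y" for y
    by (rule closedin_borel_on)
      (use assms that in \<open>auto intro: closedin_Hausdorff_singleton\<close>)
  have int: "(LINT x|point_masses Y y. g x) = g y" if "g \<in> Cc Y" "y \<in> topspace Y" for g y
    unfolding point_masses_def
    by (rule integral_return)
      (use that continuous_borel_on[OF Cc_continuous[OF assms that(1)]] in auto)
  have "continuous_family Y Y (\<lambda>y. y) (point_masses Y)"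
    unfolding continuous_family_def
  proof (intro conjI ballI)
    fix y assume y: "y \<in> topspace Y"
    show "radon Y (point_masses Y y)" by (rule radon_point_masses[OF assms y])
    have "topspace Y - {y} \<in> sets (borel_on Y)"
      using sets.compl_sets[OF sgl[OF y]] by simp
    then show "emeasure (point_masses Y y) (topspace Y - fiber Y (\<lambda>y. y) y) = 0"
      using y by (simp add: fiber_id point_masses_def)
  next
    fix g assume g: "g \<in> Cc Y"
    show "continuous_map Y euclidean (\<lambda>u. LINT x|point_masses Y u. g x)"
      by (rule continuous_map_eq[OF Cc_continuous[OF assms g]]) (simp add: int g)
  qed
  moreover have "meas_supp Y (point_masses Y y) = fiber Y (\<lambda>y. y) y" if y: "y \<in> topspace Y" for y
  proof -
    have "y \<in> meas_supp Y (point_masses Y y)"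
      using y by (auto simp: meas_supp_def point_masses_def openin_borel_on)
    moreover have "x = y" if "x \<in> meas_supp Y (point_masses Y y)" for x
    proof (rule ccontr)
      assume "x \<noteq> y"
      moreover have x: "x \<in> topspace Y" using that by (simp add: meas_supp_def)
      ultimately obtain U where "openin Y U" "x \<in> U" "y \<notin> U"
        using assms y unfolding Hausdorff_space_def disjnt_def by blast
      with that show False
        by (auto simp: meas_supp_def point_masses_def openin_borel_on)
    qed
    ultimately show ?thesis using y by (auto simp: fiber_id)
  qed
  moreover have "(LINT h:fiber Y (\<lambda>y. y) y|point_masses Y y. f y) = (LINT h|point_masses Y y. f h)"
    if "y \<in> topspace Y" "f \<in> Cc Y" for f y
  proof -
    have "(LINT h:{y}|point_masses Y y. f y) = indicator {y} y *\<^sub>R f y"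
      unfolding point_masses_def set_lebesgue_integral_def
      by (rule integral_return) (use that sgl in auto)
    then show ?thesis using that by (simp add: fiber_id int)
  qed
  ultimately show ?thesis
    unfolding haar_system_def unit_space_space_groupoid by (simp add: space_groupoid_def)
qed

end

theory Submission
  imports Defs
begin

text \<open>For spaces regarded as groupoids all actions are trivial, so the map
  \<open>(\<gamma>, x) \<mapsto> (\<gamma> x, x)\<close> is the diagonal embedding of \<open>X\<close> into
  \<open>X \<times>\<^sub>Z X\<close> and the Haar integral on the right of the adjoining formula is evaluation
  at a point. Fix \<open>x\<^sub>0\<close> over \<open>z\<close>. Every bump function \<open>\<phi>\<close> with compact support near
  \<open>x\<^sub>0\<close> and \<open>\<phi>(x\<^sub>0) = 1\<close> yields the extension \<open>\<phi>(x) \<phi>(y)\<close> of the function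
  \<open>\<phi>(x)\<^sup>2\<close> on the diagonal, and the formula at \<open>x\<^sub>0\<close> becomes
  \<open>\<integral> \<phi>(y) D(x\<^sub>0, y) d\<lambda>\<^sub>z(y) = 1\<close> (lemma \<open>adjoining_function_test_identity\<close>).

  Now let \<open>\<phi>\<close> shrink to the indicator of \<open>x\<^sub>0\<close>. Inner regularity of \<open>\<lambda>\<^sub>z\<close> makes
  the contribution of the points other than \<open>x\<^sub>0\<close> as small as desired, so the whole mass 1
  must come from \<open>x\<^sub>0\<close> itself and \<open>D(x\<^sub>0, x\<^sub>0) \<lambda>\<^sub>z({x\<^sub>0})\<close> cannot vanish
  (lemma \<open>adjoining_function_charges_point\<close>). As \<open>D\<close> is nonnegative, it is positive on the
  diagonal, and every point of every fibre is an atom of positive mass. This gives full support.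
  It also gives atomicity, because a sigma-finite measure charges at most countably many points:
  the fibre is countable, and \<open>\<lambda>\<^sub>z\<close>, being concentrated on it, is the sum of its point
  masses (lemma \<open>atomic_measure_if_points_charged\<close>).\<close>

section \<open>Atoms of sigma-finite and Radon measures\<close>

lemma countable_atoms_sigma_finite:
  assumes "sigma_finite_measure M"
  shows "countable {x \<in> space M. {x} \<in> sets M \<and> emeasure M {x} \<noteq> 0}"
proof -
  obtain A :: "nat \<Rightarrow> 'a set" where A: "range A \<subseteq> sets M" "(\<Union>i. A i) = space M"
    "\<And>i. emeasure M (A i) \<noteq> \<infinity>"
    using sigma_finite_measure.sigma_finite[OF assms] by metis
  have "countable {x. measure (restrict_space M (A i)) {x} \<noteq> 0}" for i
  proof (rule finite_measure.countable_support, rule finite_measureI)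
    show "emeasure (restrict_space M (A i)) (space (restrict_space M (A i))) \<noteq> \<infinity>"
      using A by (auto simp: space_restrict_space emeasure_restrict_space
          Int_absorb2 sets.sets_into_space)
  qed
  then have "countable (\<Union>i. {x. measure (restrict_space M (A i)) {x} \<noteq> 0})" by blast
  moreover have "x \<in> (\<Union>i. {x. measure (restrict_space M (A i)) {x} \<noteq> 0})"
    if x: "x \<in> space M" "{x} \<in> sets M" "emeasure M {x} \<noteq> 0" for x
  proof -
    from x A obtain i where i: "x \<in> A i" by blast
    have Ai: "A i \<in> sets M" using A by blast
    have "emeasure M {x} \<le> emeasure M (A i)"
      using i Ai by (intro emeasure_mono) auto
    then have "emeasure M {x} \<noteq> \<infinity>" using A(3)[of i] by (auto simp: top_unique)
    then have "measure M {x} \<noteq> 0"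
      using x by (simp add: measure_def enn2real_eq_0_iff)
    moreover have "measure (restrict_space M (A i)) {x} = measure M {x}"
      using Ai i by (intro measure_restrict_space) auto
    ultimately show ?thesis by (intro UN_I[of i]) auto
  qed
  ultimately show ?thesis by (blast intro: countable_subset)
qed

text \<open>Sigma-finiteness leaves room for only countably many points of positive mass, so a
  set \<open>F\<close> of such points is countable, and a measure concentrated on \<open>F\<close> is the sum of
  its point masses by countable additivity.\<close>

lemma atomic_measure_if_points_charged:
  assumes "sigma_finite_measure M"
    and F: "F \<in> sets M" "emeasure M (space M - F) = 0"
    and charged: "\<And>x. x \<in> F \<Longrightarrow> {x} \<in> sets M \<and> emeasure M {x} \<noteq> 0"
  shows "atomic_measure M"
  unfolding atomic_measure_def
proof
  fix A assume A: "A \<in> sets M"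
  have "countable F"
    using charged sets.sets_into_space[OF F(1)]
    by (intro countable_subset[OF _ countable_atoms_sigma_finite[OF assms(1)]]) auto
  have null: "space M - F \<in> null_sets M" using F by (intro null_setsI) auto
  have off: "emeasure M {x} = 0" if "x \<notin> F" for x
  proof (cases "{x} \<in> sets M")
    case True
    then have "{x} \<subseteq> space M - F" using that sets.sets_into_space by blast
    then show ?thesis using emeasure_mono[of "{x}" "space M - F" M] F by auto
  qed (rule emeasure_notin_sets)
  have "emeasure M A = emeasure M (A - (space M - F))"
    by (rule emeasure_Diff_null_set[OF null A, symmetric])
  also have "A - (space M - F) = A \<inter> F" using sets.sets_into_space[OF A] by blast
  also have "emeasure M (A \<inter> F) = (\<integral>\<^sup>+ x. emeasure M {x} \<partial>count_space (A \<inter> F))"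
    using \<open>countable F\<close> charged by (intro emeasure_countable_singleton) auto
  also have "\<dots> = (\<integral>\<^sup>+ x. emeasure M {x} \<partial>count_space A)"
    by (intro nn_integral_count_space_eq) (auto intro: off)
  finally show "emeasure M A = (\<integral>\<^sup>+ x. emeasure M {x} \<partial>count_space A)" .
qed

lemma radon_compact_approximation:
  assumes "radon P M" "Hausdorff_space P" "A \<in> sets M" "emeasure M A \<noteq> \<infinity>" "0 < e"
  obtains C where "compactin P C" "C \<subseteq> A" "measure M (A - C) < e"
proof -
  have sM: "sets M = sets (borel_on P)" and sp: "space M = topspace P"
    using assms(1) by (auto simp: radon_def)
  have "A \<subseteq> topspace P" using sets.sets_into_space[OF assms(3)] sp by simp
  then have *: "emeasure M A = (SUP K \<in> {K. compactin P K \<and> K \<subseteq> A}. emeasure M K)"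
    using assms(1-3) unfolding radon_def
    by (metis openin_topspace subtopology_topspace)
  have "{K. compactin P K \<and> K \<subseteq> A} \<noteq> {}" by (auto intro!: exI[of _ "{}"])
  from SUP_approx_ennreal[OF assms(5) this * assms(4)]
  obtain C where C: "compactin P C" "C \<subseteq> A" "emeasure M A < emeasure M C + ennreal e" by blast
  have CM: "C \<in> sets M"
    using C(1) assms(2) sM by (metis closedin_borel_on compactin_imp_closedin)
  have Cfin: "emeasure M C \<noteq> \<infinity>"
    using emeasure_mono[OF C(2) assms(3)] assms(4) by (auto simp: top_unique)
  have "ennreal (measure M A) < ennreal (measure M C + e)"
    using C(3) Cfin assms(4,5) by (simp add: emeasure_eq_ennreal_measure)
  then have "measure M A < measure M C + e"
    by (subst (asm) ennreal_less_iff) auto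
  moreover have "measure M (A - C) = measure M A - measure M C"
    using assms(3,4) CM C(2) by (intro measure_Diff) auto
  ultimately have "measure M (A - C) < e" by simp
  with C that show thesis by blast
qed

section \<open>The adjoining function on the diagonal\<close>

lemma compactly_supported_in_Cc_in:
  assumes "Hausdorff_space P" "continuous_map P euclidean g"
    "compactin P K" "K \<subseteq> U" "\<And>p. p \<notin> K \<Longrightarrow> g p = 0"
  shows "g \<in> Cc_in P U"
proof -
  have "g \<in> Cc P"
    using assms compactin_subset_topspace[OF assms(3)]
    by (intro Cc.gen[where U = "topspace P" and K = K]) auto
  moreover have "fun_supp P g \<subseteq> K"
    unfolding fun_supp_def using assms(5) compactin_imp_closedin[OF assms(1,3)]
    by (intro closure_of_minimal) auto
  ultimately show ?thesis using assms(4) by (auto simp: Cc_in_def)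
qed

text \<open>The adjoining formula tested on products of bump functions. Write \<open>U\<close> for the member
  of the cover through the diagonal point at \<open>x\<^sub>0\<close> and \<open>U'\<close> for an extension of it. As
  \<open>U'\<close> is open, it contains the part of a square \<open>W \<times> W\<close> lying over the diagonal of
  \<open>Z\<close>, so \<open>\<phi>(x) \<phi>(y)\<close> is supported in \<open>U'\<close> as soon as \<open>\<phi>\<close> is
  supported in \<open>W\<close>. Its restriction to the diagonal is then supported in \<open>U\<close>, because
  \<open>U'\<close> meets the diagonal in the image of \<open>U\<close> only. The indicator records that
  \<open>D(x\<^sub>0, y)\<close> is meaningful only for \<open>y\<close> in the fibre of \<open>x\<^sub>0\<close>.\<close>

lemma adjoining_function_test_identity:
  fixes Y :: "'y topology" and Z :: "'z topology" and X :: "'x topology"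
  assumes Y: "Hausdorff_space Y" and Z: "Hausdorff_space Z" and X: "Hausdorff_space X"
    and b: "continuous_map X Y b" and f: "continuous_map X Z f"
    and adj: "adjoining_function (space_groupoid Y) (point_masses Y) (space_groupoid Z)
                (space_bispace X b f) lam D"
    and x0: "x0 \<in> topspace X"
  obtains W where "openin X W" "x0 \<in> W"
    "\<And>\<phi> K. continuous_map X euclideanreal \<phi> \<Longrightarrow> compactin X K \<Longrightarrow> K \<subseteq> W \<Longrightarrow>
       (\<And>x. x \<in> topspace X - K \<Longrightarrow> \<phi> x = 0) \<Longrightarrow>
       (LINT y|lam (f x0). indicator (fiber X f (f x0)) y * (\<phi> x0 * \<phi> y) * D (x0, y)) = (\<phi> x0)\<^sup>2"
proof -
  define P where "P = subtopology (prod_topology Y X) {(y, x). y = b x}"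
  define Q where "Q = subtopology (prod_topology X X) {(x, y). f x = f y}"
  define m where "m = (\<lambda>(y :: 'y, x :: 'x). (x, x))"
  have simps: "lprod (space_groupoid Y) (space_bispace X b f) = P"
    "fibprod (space_bispace X b f) = Q" "mmap (space_bispace X b f) = m"
    by (simp_all add: lprod_def fibprod_def mmap_def space_groupoid_def space_bispace_def
        P_def Q_def m_def)
  have HP: "Hausdorff_space P" and HQ: "Hausdorff_space Q"
    using X Y by (simp_all add: P_def Q_def Hausdorff_space_subtopology Hausdorff_space_prod_topology)
  have tP: "topspace P = {(y, x). x \<in> topspace X \<and> y = b x}"
    using continuous_map_image_subset_topspace[OF b] by (auto simp: P_def)
  have tQ: "topspace Q = {(x, y). x \<in> topspace X \<and> y \<in> topspace X \<and> f x = f y}"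
    by (auto simp: Q_def)
  obtain \<A> \<A>' where cov: "\<Union>\<A> = topspace P" "cover_ext P Q m \<A> \<A>'"
    and int: "\<And>U U' g g' x. U \<in> \<A> \<Longrightarrow> U' \<in> \<A>' \<Longrightarrow> set_ext P Q m U U' \<Longrightarrow> g \<in> Cc_in P U \<Longrightarrow>
       g' \<in> Cc_in Q U' \<Longrightarrow> (\<forall>p\<in>U. g' (m p) = g p) \<Longrightarrow> x \<in> topspace X \<Longrightarrow>
       (LINT y|lam (f x). g' (x, y) * of_real (D (x, y)))
         = (LINT k:fiber Y (\<lambda>y. y) (b x)|point_masses Y (b x). g (k, x))"
    using adj unfolding adjoining_function_def simps
    by (auto simp: space_groupoid_def space_bispace_def)
  have "(b x0, x0) \<in> topspace P" using x0 by (simp add: tP)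
  then obtain U where U: "U \<in> \<A>" "(b x0, x0) \<in> U" using cov(1) by blast
  then obtain U' where U': "U' \<in> \<A>'" and ext: "set_ext P Q m U U'"
    using cov(2) by (auto simp: cover_ext_def)
  have oU: "openin P U" and oU': "openin Q U'" and img: "U' \<inter> m ` topspace P = m ` U"
    using ext by (auto simp: set_ext_def)
  have "(x0, x0) \<in> U'" using U(2) img by (force simp: m_def)
  moreover obtain T where T: "openin (prod_topology X X) T" "U' = T \<inter> {(x, y). f x = f y}"
    using oU' by (auto simp: Q_def openin_subtopology)
  ultimately have "(x0, x0) \<in> T" by blast
  then obtain W1 W2 where W12: "openin X W1" "openin X W2" "x0 \<in> W1" "x0 \<in> W2" "W1 \<times> W2 \<subseteq> T"
    using T(1) unfolding openin_prod_topology_alt by metis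
  define W where "W = W1 \<inter> W2"
  have W: "openin X W" "x0 \<in> W" using W12 by (auto simp: W_def)
  have WU': "(x, y) \<in> U'" if "x \<in> W" "y \<in> W" "f x = f y" for x y
    using that W12 T by (auto simp: W_def)
  have WU: "(b x, x) \<in> U" if "x \<in> W" for x
  proof -
    have "x \<in> topspace X" using that openin_subset[OF W(1)] by blast
    then have "(x, x) \<in> U' \<inter> m ` topspace P"
      using WU'[OF that that] by (force simp: tP m_def)
    then obtain p where "p \<in> U" "m p = (x, x)" using img by force
    moreover have "U \<subseteq> topspace P" using oU by (rule openin_subset)
    ultimately show ?thesis by (auto simp: m_def tP)
  qed
  show thesis
  proof (rule that[OF W])
    fix \<phi> K
    assume \<phi>: "continuous_map X euclideanreal \<phi>" and K: "compactin X K" "K \<subseteq> W"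
      and van: "\<And>x. x \<in> topspace X - K \<Longrightarrow> \<phi> x = 0"
    \<comment> \<open>Both functions are set to 0 off the space that carries them: elements of \<^const>\<open>Cc\<close>
      vanish at every value of the type outside a compact set.\<close>
    define g :: "'y \<times> 'x \<Rightarrow> complex"
      where "g = (\<lambda>p. if p \<in> topspace P then of_real (\<phi> (snd p) * \<phi> (snd p)) else 0)"
    define g' :: "'x \<times> 'x \<Rightarrow> complex"
      where "g' = (\<lambda>p. if p \<in> topspace Q then of_real (\<phi> (fst p) * \<phi> (snd p)) else 0)"
    have \<phi>P: "continuous_map P euclideanreal (\<lambda>p. \<phi> (snd p))"
      and \<phi>Q: "continuous_map Q euclideanreal (\<lambda>p. \<phi> (fst p))"
              "continuous_map Q euclideanreal (\<lambda>p. \<phi> (snd p))"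
      unfolding P_def Q_def
      by (intro continuous_map_from_subtopology continuous_map_compose[OF _ \<phi>, unfolded o_def]
          continuous_map_fst continuous_map_snd)+
    have cplx: "continuous_map euclidean euclidean complex_of_real"
      by (simp add: continuous_intros)
    have gc: "continuous_map P euclidean g"
      by (rule continuous_map_eq[OF continuous_map_compose[OF
            continuous_map_real_mult[OF \<phi>P \<phi>P] cplx]]) (simp add: g_def)
    have g'c: "continuous_map Q euclidean g'"
      by (rule continuous_map_eq[OF continuous_map_compose[OF
            continuous_map_real_mult[OF \<phi>Q] cplx]]) (simp add: g'_def)
    have in_K: "x \<in> K" if "x \<in> topspace X" "\<phi> x \<noteq> 0" for x using van that by blast
    have "continuous_map X P (\<lambda>x. (b x, x))"
      using b unfolding P_def by (auto simp: continuous_map_in_subtopology continuous_map_paired)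
    from image_compactin[OF K(1) this] have KP: "compactin P ((\<lambda>x. (b x, x)) ` K)" .
    have g: "g \<in> Cc_in P U"
      by (rule compactly_supported_in_Cc_in[OF HP gc KP])
         (use K(2) in \<open>auto simp: g_def tP intro: WU van\<close>)
    have "closedin (prod_topology X X) {p \<in> topspace (prod_topology X X). f (fst p) = f (snd p)}"
      by (intro closedin_continuous_maps_eq[OF Z] continuous_map_compose[OF _ f, unfolded o_def]
          continuous_map_fst continuous_map_snd)
    from closed_Int_compactin[OF this, of "K \<times> K"] K(1)
    have "compactin (prod_topology X X)
        ({p \<in> topspace (prod_topology X X). f (fst p) = f (snd p)} \<inter> K \<times> K)"
      by (simp add: compactin_Times)
    then have KQ: "compactin Q
        ({p \<in> topspace (prod_topology X X). f (fst p) = f (snd p)} \<inter> K \<times> K)"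
      unfolding Q_def by (auto simp: compactin_subtopology)
    have g': "g' \<in> Cc_in Q U'"
      by (rule compactly_supported_in_Cc_in[OF HQ g'c KQ])
         (use K(2) in \<open>auto simp: g'_def tQ intro: WU' in_K\<close>)
    have "\<forall>p\<in>U. g' (m p) = g p"
      using openin_subset[OF oU] by (auto simp: g_def g'_def tP tQ m_def)
    from int[OF U(1) U' ext g g' this x0]
    have eq: "(LINT y|lam (f x0). g' (x0, y) * of_real (D (x0, y)))
      = (LINT k:fiber Y (\<lambda>y. y) (b x0)|point_masses Y (b x0). g (k, x0))" .
    have bx0: "b x0 \<in> topspace Y" using b x0 continuous_map_image_subset_topspace by blast
    have sgl: "{b x0} \<in> sets (borel_on Y)"
      by (rule closedin_borel_on) (use Y bx0 in \<open>auto intro: closedin_Hausdorff_singleton\<close>)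
    have "(LINT k:fiber Y (\<lambda>y. y) (b x0)|point_masses Y (b x0). g (k, x0))
        = (LINT k|return (borel_on Y) (b x0). indicator {b x0} k *\<^sub>R g (b x0, x0))"
      using bx0 unfolding set_lebesgue_integral_def point_masses_def
      by (intro Bochner_Integration.integral_cong) (auto simp: fiber_id split: split_indicator)
    also have "\<dots> = indicator {b x0} (b x0) *\<^sub>R g (b x0, x0)"
      by (rule integral_return) (use bx0 sgl in auto)
    also have "\<dots> = of_real ((\<phi> x0)\<^sup>2)"
      using x0 by (simp add: g_def tP power2_eq_square)
    finally have r: "(LINT k:fiber Y (\<lambda>y. y) (b x0)|point_masses Y (b x0). g (k, x0))
      = of_real ((\<phi> x0)\<^sup>2)" .
    have "(LINT y|lam (f x0). g' (x0, y) * of_real (D (x0, y))) = (LINT y|lam (f x0).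
        complex_of_real (indicator (fiber X f (f x0)) y * (\<phi> x0 * \<phi> y) * D (x0, y)))"
      using x0 by (intro Bochner_Integration.integral_cong)
        (auto simp: g'_def tQ fiber_def split: split_indicator)
    also have "\<dots> = of_real (LINT y|lam (f x0).
        indicator (fiber X f (f x0)) y * (\<phi> x0 * \<phi> y) * D (x0, y))"
      by (rule integral_complex_of_real)
    finally show "(LINT y|lam (f x0). indicator (fiber X f (f x0)) y * (\<phi> x0 * \<phi> y) * D (x0, y))
      = (\<phi> x0)\<^sup>2"
      unfolding eq r by (simp only: of_real_eq_iff)
  qed
qed

text \<open>If the product vanished, the point \<open>x\<^sub>0\<close> would contribute nothing to the integral 1
  of the test identity. The remaining contribution is at most a bound for \<open>D(x\<^sub>0, \<cdot>)\<close>
  on a compact neighbourhood times the mass of the part of the punctured neighbourhood on which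
  \<open>\<phi>\<close> is nonzero. By inner regularity \<open>\<phi>\<close> can be chosen to vanish on so large a compact part
  of the punctured neighbourhood that this is less than 1.\<close>

lemma adjoining_function_charges_point:
  fixes Y :: "'y topology" and Z :: "'z topology" and X :: "'x topology"
  assumes Y: "Hausdorff_space Y" and Z: "Hausdorff_space Z" and X: "Hausdorff_space X"
    and lc: "locally_compact_space X"
    and b: "continuous_map X Y b" and f: "continuous_map X Z f"
    and adj: "adjoining_function (space_groupoid Y) (point_masses Y) (space_groupoid Z)
                (space_bispace X b f) lam D"
    and x0: "x0 \<in> topspace X" and rad: "radon X (lam (f x0))"
  shows "D (x0, x0) * measure (lam (f x0)) {x0} \<noteq> 0"
proof
  assume zero: "D (x0, x0) * measure (lam (f x0)) {x0} = 0"
  define M where "M = lam (f x0)"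
  define F where "F = fiber X f (f x0)"
  have sM: "sets M = sets (borel_on X)" and sp: "space M = topspace X"
    using rad by (auto simp: radon_def M_def)
  have cl: "C \<in> sets M" if "compactin X C" for C
    using that X sM by (metis closedin_borel_on compactin_imp_closedin)
  have fin: "emeasure M C < \<infinity>" if "compactin X C" for C
    using rad that X compactin_subset_topspace[OF that] unfolding radon_def M_def
    by (metis openin_topspace subtopology_topspace)
  obtain W where W: "openin X W" "x0 \<in> W" and test: "\<And>\<phi> K. continuous_map X euclideanreal \<phi> \<Longrightarrow>
       compactin X K \<Longrightarrow> K \<subseteq> W \<Longrightarrow> (\<And>x. x \<in> topspace X - K \<Longrightarrow> \<phi> x = 0) \<Longrightarrow>
       (LINT y|M. indicator F y * (\<phi> x0 * \<phi> y) * D (x0, y)) = (\<phi> x0)\<^sup>2"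
    by (rule adjoining_function_test_identity[OF Y Z X b f adj x0, folded M_def F_def])
      (erule (1) that, blast)
  have "neighbourhood_base_of (\<lambda>C. compactin X C \<and> closedin X C) X"
    using lc X locally_compact_space_neighbourhood_base_closedin by blast
  then obtain V K where V: "openin X V" "x0 \<in> V" "V \<subseteq> K" and K: "compactin X K" "K \<subseteq> W"
    using W unfolding neighbourhood_base_of by metis
  have x0K: "x0 \<in> K" using V by blast
  obtain B where B: "0 < B" "\<And>y. y \<in> K \<inter> F \<Longrightarrow> \<bar>D (x0, y)\<bar> \<le> B"
  proof -
    have "continuous_map (subtopology X F)
        (subtopology (prod_topology X X) {(x, y). f x = f y}) (\<lambda>y. (x0, y))"
      using x0 by (auto simp: continuous_map_in_subtopology continuous_map_paired F_def fiber_def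
          continuous_map_from_subtopology)
    moreover have "continuous_map (subtopology (prod_topology X X) {(x, y). f x = f y})
        euclideanreal D"
      using adj by (simp add: adjoining_function_def fibprod_def space_bispace_def)
    ultimately have c: "continuous_map (subtopology X F) euclideanreal (D \<circ> (\<lambda>y. (x0, y)))"
      by (rule continuous_map_compose)
    have "closedin X {x \<in> topspace X. f x = f x0}"
      using closedin_continuous_maps_eq[OF Z f, of "\<lambda>_. f x0"] f x0
        continuous_map_image_subset_topspace[OF f] by auto
    then have "compactin X (F \<inter> K)"
      using K(1) unfolding F_def fiber_def by (rule closed_Int_compactin)
    then have "compactin (subtopology X F) (F \<inter> K)" by (simp add: compactin_subtopology)
    from image_compactin[OF this c] have "bounded ((D \<circ> (\<lambda>y. (x0, y))) ` (F \<inter> K))"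
      by (simp add: compact_imp_bounded)
    then show thesis using that unfolding bounded_pos by auto
  qed
  have A: "K - {x0} \<in> sets M" using cl[OF K(1)] cl[of "{x0}"] x0 by auto
  have Afin: "emeasure M (K - {x0}) \<noteq> \<infinity>"
    using emeasure_mono[of "K - {x0}" K M] cl[OF K(1)] fin[OF K(1)] by (auto simp: top_unique)
  obtain C where C: "compactin X C" "C \<subseteq> K - {x0}" "measure M (K - {x0} - C) < 1 / B"
    using radon_compact_approximation[OF rad X, folded M_def, OF A Afin, of "1 / B"] B(1) by auto
  have "completely_regular_space X"
    using lc X by (simp add: locally_compact_regular_imp_completely_regular_space)
  moreover have "closedin X ((topspace X - V) \<union> C)"
    using V(1) compactin_imp_closedin[OF X C(1)] by (intro closedin_Un) auto
  moreover have "x0 \<in> topspace X - ((topspace X - V) \<union> C)" using x0 V C by auto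
  ultimately obtain \<psi> where \<psi>: "continuous_map X (top_of_set {0..1::real}) \<psi>" "\<psi> x0 = 0"
      "\<psi> ` ((topspace X - V) \<union> C) \<subseteq> {1}"
    unfolding completely_regular_space_def by metis
  \<comment> \<open>Complete regularity provides a function that is 0 at the point and 1 on the closed set.\<close>
  define \<phi> where "\<phi> = (\<lambda>x. 1 - \<psi> x)"
  have \<phi>c: "continuous_map X euclideanreal \<phi>"
    using \<psi>(1) unfolding \<phi>_def
    by (intro continuous_map_diff) (auto simp: continuous_map_in_subtopology)
  have \<phi>1: "\<phi> x0 = 1" using \<psi> by (simp add: \<phi>_def)
  have \<phi>0: "\<phi> x = 0" if "x \<in> topspace X - V \<or> x \<in> C" for x
    using \<psi>(3) that by (auto simp: \<phi>_def)
  have \<phi>b: "0 \<le> \<phi> x \<and> \<phi> x \<le> 1" if "x \<in> topspace X" for x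
    using \<psi>(1) that by (auto simp: \<phi>_def continuous_map_in_subtopology)
  \<comment> \<open>\<open>?h\<close> dominates the test integrand, whose value at \<open>x0\<close> is \<open>D (x0, x0)\<close>;
    the choice of \<open>C\<close> keeps the first summand's integral below 1.\<close>
  let ?h = "\<lambda>y. B * indicator (K - {x0} - C) y + D (x0, x0) * indicator {x0} y :: real"
  have D0: "0 \<le> D (x0, x0)"
    using adj x0 by (simp add: adjoining_function_def fibprod_def space_bispace_def)
  have S: "K - {x0} - C \<in> sets M" "{x0} \<in> sets M" using A cl[OF C(1)] cl[of "{x0}"] x0 by auto
  have Sfin: "emeasure M (K - {x0} - C) < \<infinity>" "emeasure M {x0} < \<infinity>"
    using le_less_trans[OF emeasure_mono[of "K - {x0} - C" K M] fin[OF K(1)]] cl[OF K(1)]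
      fin[of "{x0}"] x0
    by auto
  have "1 = (LINT y|M. indicator F y * (\<phi> x0 * \<phi> y) * D (x0, y))"
    using test[OF \<phi>c K] \<phi>0 V \<phi>1 by auto
  also have "\<dots> \<le> (LINT y|M. ?h y)"
  proof (rule integral_mono')
    show "integrable M ?h" using S Sfin by simp
  next
    fix y assume "y \<in> space M"
    then have y: "y \<in> topspace X" by (simp add: sp)
    show "0 \<le> ?h y" using B D0 by (simp add: indicator_def)
    show "indicator F y * (\<phi> x0 * \<phi> y) * D (x0, y) \<le> ?h y"
    proof (cases "y = x0 \<or> y \<notin> F \<or> y \<in> C \<or> y \<notin> V")
      case True
      then show ?thesis using \<phi>0[of y] y \<phi>1 D0 B(1) by (auto simp: indicator_def)
    next
      case False
      then have "y \<in> K \<inter> F" using V by blast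
      then have "\<phi> y * D (x0, y) \<le> 1 * B"
        using B(2)[of y] \<phi>b[OF y] B(1)
        by (intro order_trans[OF mult_left_mono mult_right_mono]) auto
      then show ?thesis using False V \<phi>1 by (auto simp: indicator_def)
    qed
  qed
  also have "\<dots> = B * measure M (K - {x0} - C) + D (x0, x0) * measure M {x0}"
    using S Sfin by simp
  also have "\<dots> < 1" using zero C(3) B(1) by (auto simp: M_def field_simps)
  finally show False by simp
qed

theorem lemma3p8:
  fixes Y :: "'y topology" and Z :: "'z topology" and X :: "'x topology"
    and b :: "'x \<Rightarrow> 'y" and f :: "'x \<Rightarrow> 'z" and lam :: "'z \<Rightarrow> 'x measure"
  assumes "locally_compact_space Y" and "Hausdorff_space Y"
    and "locally_compact_space Z" and "Hausdorff_space Z"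
    and "topological_correspondence (space_groupoid Y) (point_masses Y)
           (space_groupoid Z) (point_masses Z) (space_bispace X b f) lam"
    and "proper_correspondence (space_groupoid Y) (point_masses Y)
           (space_groupoid Z) (space_bispace X b f) lam"
  shows "(\<forall>z\<in>topspace Z. atomic_measure (lam z)) \<and>
    (\<forall>z\<in>topspace Z. \<forall>x\<in>fiber X f z. emeasure (lam z) {x} \<noteq> 0) \<and>
    (\<forall>D. adjoining_function (space_groupoid Y) (point_masses Y) (space_groupoid Z)
           (space_bispace X b f) lam D \<longrightarrow> (\<forall>x\<in>topspace X. 0 < D (x, x))) \<and>
    (\<forall>z\<in>topspace Z. meas_supp X (lam z) = fiber X f z)"
proof -
  note tc = assms(5)[unfolded topological_correspondence_def]
  have X: "Hausdorff_space X" using assms(6)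
    by (simp add: proper_correspondence_def space_bispace_def)
  have "loc_compact X" using tc by (simp add: space_bispace_def)
  then have lc: "locally_compact_space X"
    unfolding loc_compact_def locally_compact_space_def by metis
  have b: "continuous_map X Y b" and f: "continuous_map X Z f"
    using tc by (simp_all add: is_bispace_def left_space_def right_space_def) 
      (simp_all add: space_bispace_def)
  have "continuous_family X Z f lam" using tc by (simp add: space_bispace_def)
  then have rad: "radon X (lam z)" and conc: "emeasure (lam z) (topspace X - fiber X f z) = 0"
    if "z \<in> topspace Z" for z using that by (auto simp: continuous_family_def)
  have fZ: "f x \<in> topspace Z" if "x \<in> topspace X" for x
    using that continuous_map_image_subset_topspace[OF f] by blast
  have charge: "D (x, x) * measure (lam (f x)) {x} \<noteq> 0"
    if "adjoining_function (space_groupoid Y) (point_masses Y) (space_groupoid Z)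
           (space_bispace X b f) lam D" "x \<in> topspace X" for D x
    using adjoining_function_charges_point[OF assms(2,4) X lc b f that rad[OF fZ[OF that(2)]]] .
  obtain D0 where D0: "adjoining_function (space_groupoid Y) (point_masses Y) (space_groupoid Z)
           (space_bispace X b f) lam D0"
    using assms(6) by (auto simp: proper_correspondence_def)
  have atom: "emeasure (lam z) {x} \<noteq> 0" if "x \<in> fiber X f z" for x z
    using charge[OF D0, of x] that by (auto simp: fiber_def measure_def)
  have pos: "0 < D (x, x)"
    if "adjoining_function (space_groupoid Y) (point_masses Y) (space_groupoid Z)
           (space_bispace X b f) lam D" "x \<in> topspace X" for D x
  proof -
    have "0 \<le> D (x, x)" using that
      by (simp add: adjoining_function_def fibprod_def space_bispace_def)
    then show ?thesis using charge[OF that] by (auto simp: less_le)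
  qed
  have sgl: "{x} \<in> sets (lam z)" if "x \<in> topspace X" "z \<in> topspace Z" for x z
    using rad[OF that(2)] that X closedin_borel_on[of X "{x}"]
    by (auto simp: radon_def closedin_Hausdorff_singleton)
  have fib: "closedin X (fiber X f z)" if "z \<in> topspace Z" for z
    using closedin_continuous_maps_eq[OF assms(4) f, of "\<lambda>_. z"] that
    by (auto simp: fiber_def)
  have atomic: "atomic_measure (lam z)" if z: "z \<in> topspace Z" for z
  proof (rule atomic_measure_if_points_charged)
    show "sigma_finite_measure (lam z)" using rad[OF z] by (simp add: radon_def)
    show "fiber X f z \<in> sets (lam z)"
      using rad[OF z] closedin_borel_on[OF fib[OF z]] by (simp add: radon_def)
    show "emeasure (lam z) (space (lam z) - fiber X f z) = 0"
      using rad[OF z] conc[OF z] by (simp add: radon_def)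
    show "{x} \<in> sets (lam z) \<and> emeasure (lam z) {x} \<noteq> 0" if "x \<in> fiber X f z" for x
      using atom[OF that] sgl[OF _ z] that by (simp add: fiber_def)
  qed
  have supp: "meas_supp X (lam z) = fiber X f z" if z: "z \<in> topspace Z" for z
  proof
    show "meas_supp X (lam z) \<subseteq> fiber X f z"
      using fib[OF z] conc[OF z] by (auto simp: meas_supp_def closedin_def)
    show "fiber X f z \<subseteq> meas_supp X (lam z)"
    proof
      fix x assume x: "x \<in> fiber X f z"
      have "emeasure (lam z) U \<noteq> 0" if "openin X U" "x \<in> U" for U
      proof -
        have "U \<in> sets (lam z)"
          using rad[OF z] openin_borel_on[OF that(1)] by (simp add: radon_def)
        then have "emeasure (lam z) {x} \<le> emeasure (lam z) U"
          using that by (intro emeasure_mono) auto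
        then show ?thesis using atom[OF x] by auto
      qed
      then show "x \<in> meas_supp X (lam z)" using x by (simp add: meas_supp_def fiber_def)
    qed
  qed
  show ?thesis using atomic atom pos supp by blast
qed

end
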